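(* Let $N,d\in\mathbb{N}$ and let $\rho\in(0,2]$ with $\rho>\rho_c:=d\frac{N-1}{N+1}$. If $\kappa>0$ is small enough, the homogeneity counting map satisfies $$\frac{\rho+d}{N+1}\,(\rho-\rho_c)^{-1}\ \le\ h_F(N,d,\rho)\ \le\ 1+\frac{(\rho+d)\,d\,N}{N+1}\,(\rho-\rho_c)^{-1}.$$
   Context: $h_F$ counts the negative homogeneities in the model space associated with the SPDE $\partial_tu=\Delta^{\rho/2}u+f(u)+\xi$ on $\mathbb{T}^d$, $f$ a polynomial of degree $N$, $\xi$ space-time white noise. Precisely: Scaling $\mathfrak{s}=(\rho,1,\dots,1)$; for $k\in\mathbb{N}_0^{d+1}$, $|k|_{\mathfrak{s}}=\rho k_0+k_1+\dots+k_d$. Let $\alpha_0=-\frac{\rho+d}{2}-\kappa$. Formal symbols are built from $\mathbf{1}$, $X_0,\dots,X_d$, $\Xi$ by a commutative associative product with unit $\mathbf{1}$ and a unary operation $\mathcal{I}_\rho$; $X^k=X_0^{k_0}\cdots X_d^{k_d}$. By convention $\mathcal{I}_\rho(X^k)=0$ for all $k$ (in particular $\mathcal{I}_\rho(\mathbf{1})=0$), and $0$ is not listed as a symbol. Set $\mathcal{W}_0=\mathcal{U}_0=\emptyset$ and, for $m\ge1$, $$\mathcal{W}_m=\mathcal{W}_{m-1}\cup\{\Xi\}\cup\bigcup_{n=1}^N\{\tau_1\cdots\tau_n:\tau_i\in\mathcal{U}_{m-1}\},\qquad \mathcal{U}_m=\{X^k:k\in\mathbb{N}_0^{d+1}\}\cup\{\mathcal{I}_\rho(\tau):\tau\in\mathcal{W}_m\},$$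 and $\mathcal{F}_F=\bigcup_{m\ge0}(\mathcal{W}_m\cup\mathcal{U}_m)$. The homogeneity is defined by $|\Xi|_{\mathfrak{s}}=\alpha_0$, $|X^k|_{\mathfrak{s}}=|k|_{\mathfrak{s}}$, $|\mathcal{I}_\rho(\tau)|_{\mathfrak{s}}=|\tau|_{\mathfrak{s}}+\rho$ and $|\tau\bar\tau|_{\mathfrak{s}}=|\tau|_{\mathfrak{s}}+|\bar\tau|_{\mathfrak{s}}$. Then $$h_F(N,d,\rho)=\bigl|\{\gamma<0:\exists\,\tau\in\mathcal{F}_F\text{ with }|\tau|_{\mathfrak{s}}=\gamma\}\bigr|.$$ *)

theory Defs
  imports Complex_Main "HOL-Library.Multiset"
begin

text \<open>
  A symbol is an element of the free commutative monoid over the atoms \<open>\<Xi>\<close>, \<open>X\<^sub>i\<close> and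
  \<open>\<I>\<^sub>\<rho>(\<tau>)\<close>, that is, a finite multiset of atoms: the product is \<open>+\<close> and the unit \<open>\<one>\<close> is
  \<open>{#}\<close>.
\<close>

datatype atom = Noise | Var nat | Integ "atom multiset"

type_synonym symbol = "atom multiset"

definition monomial :: "nat \<Rightarrow> (nat \<Rightarrow> nat) \<Rightarrow> symbol" where
  "monomial d k = (\<Sum>i\<le>d. replicate_mset (k i) (Var i))"

text \<open>A multiindex is a function \<open>k\<close> of which only the values at \<open>0, \<dots>, d\<close> are used.\<close>

definition monomials :: "nat \<Rightarrow> symbol set" where
  "monomials d = {monomial d k | k. True}"

text \<open>
  The symbol \<open>\<I>\<^sub>\<rho>(\<tau>)\<close> is only formed if \<open>\<tau>\<close> is not a monomial, since \<open>\<I>\<^sub>\<rho>(X\<^sup>k) = 0\<close> and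
  \<open>0\<close> is not a symbol.
\<close>

fun \<W> :: "nat \<Rightarrow> nat \<Rightarrow> nat \<Rightarrow> symbol set"
  and \<U> :: "nat \<Rightarrow> nat \<Rightarrow> nat \<Rightarrow> symbol set" where
  "\<W> N d 0 = {}"
| "\<W> N d (Suc m) = \<W> N d m \<union> {{#Noise#}}
     \<union> (\<Union>n\<in>{1..N}. {\<Sum>i=1..n. \<tau> i | \<tau>. \<forall>i\<in>{1..n}. \<tau> i \<in> \<U> N d m})"
| "\<U> N d 0 = {}"
| "\<U> N d (Suc m) = monomials d
     \<union> {{#Integ \<tau>#} | \<tau>. \<tau> \<in> \<W> N d (Suc m) \<and> \<tau> \<notin> monomials d}"

definition \<F> :: "nat \<Rightarrow> nat \<Rightarrow> symbol set" where
  "\<F> N d = (\<Union>m. \<W> N d m \<union> \<U> N d m)"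

text \<open>The regularity of space-time white noise for the scaling \<open>(\<rho>, 1, \<dots>, 1)\<close>.\<close>

definition noise_hom :: "nat \<Rightarrow> real \<Rightarrow> real \<Rightarrow> real" where
  "noise_hom d \<rho> \<kappa> = - (\<rho> + real d) / 2 - \<kappa>"

primrec atom_hom :: "nat \<Rightarrow> real \<Rightarrow> real \<Rightarrow> atom \<Rightarrow> real" where
  "atom_hom d \<rho> \<kappa> Noise = noise_hom d \<rho> \<kappa>"
| "atom_hom d \<rho> \<kappa> (Var i) = (if i = 0 then \<rho> else 1)"
| "atom_hom d \<rho> \<kappa> (Integ \<tau>) = sum_mset (image_mset (atom_hom d \<rho> \<kappa>) \<tau>) + \<rho>"

definition homogeneity :: "nat \<Rightarrow> real \<Rightarrow> real \<Rightarrow> symbol \<Rightarrow> real" where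
  "homogeneity d \<rho> \<kappa> \<tau> = (\<Sum>a\<in>#\<tau>. atom_hom d \<rho> \<kappa> a)"

text \<open>
  As \<open>card\<close> of an infinite set is \<open>0\<close>, any positive lower bound on \<open>h\<^sub>F\<close> entails that the set
  of negative homogeneities is finite.
\<close>

definition h\<^sub>F :: "nat \<Rightarrow> nat \<Rightarrow> real \<Rightarrow> real \<Rightarrow> nat" where
  "h\<^sub>F N d \<rho> \<kappa> = card {\<gamma>. \<gamma> < 0 \<and> (\<exists>\<tau>\<in>\<F> N d. homogeneity d \<rho> \<kappa> \<tau> = \<gamma>)}"

definition \<rho>\<^sub>c :: "nat \<Rightarrow> nat \<Rightarrow> real" where
  "\<rho>\<^sub>c N d = real d * (real N - 1) / (real N + 1)"

end

theory Submission imports Defs begin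

text \<open>
  Write \<open>\<beta> = |\<I>\<^sub>\<rho>(\<Xi>)| = (\<rho> - d)/2 - \<kappa>\<close> and \<open>G = \<rho> + (N - 1) \<beta>\<close>; for \<open>\<kappa> = 0\<close> this is
  \<open>G = (N + 1) (\<rho> - \<rho>\<^sub>c) / 2\<close>.  A symbol other than \<open>\<Xi>\<close> with \<open>p\<close> noises has homogeneity
  \<open>p \<beta> + e \<rho> + j\<close>, and since every vertex of the corresponding tree has at most \<open>N\<close> branches,
  \<open>p \<le> N + e (N - 1)\<close>.  With \<open>b = N + e (N - 1) - p\<close> this is \<open>N \<beta> + e G - b \<beta> + j\<close>, whose
  negativity forces \<open>e < \<lfloor>x\<rfloor>\<close>, \<open>b < N\<close> and \<open>j < d\<close> when \<open>\<kappa>\<close> is small, where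
  \<open>x = (\<rho> + d) / (2 G)\<close> with \<open>G\<close> taken at \<open>\<kappa> = 0\<close>; this gives the upper bound, the additional
  \<open>1\<close> accounting for \<open>\<Xi>\<close>.  The lower bound comes from the trees in which all vertices have
  exactly \<open>N\<close> branches: they have the homogeneities \<open>|\<Xi>| + a G\<close> with \<open>a \<in> \<nat>\<close>, which are
  negative for \<open>a < x\<close>.
\<close>

section \<open>Homogeneities of products and monomials\<close>

lemma homogeneity_empty [simp]: "homogeneity d \<rho> \<kappa> {#} = 0"
  and homogeneity_add [simp]:
    "homogeneity d \<rho> \<kappa> (\<sigma> + \<tau>) = homogeneity d \<rho> \<kappa> \<sigma> + homogeneity d \<rho> \<kappa> \<tau>"
  and homogeneity_Noise [simp]: "homogeneity d \<rho> \<kappa> {#Noise#} = noise_hom d \<rho> \<kappa>"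
  and homogeneity_Integ [simp]: "homogeneity d \<rho> \<kappa> {#Integ \<tau>#} = homogeneity d \<rho> \<kappa> \<tau> + \<rho>"
  by (simp_all add: homogeneity_def)

lemma homogeneity_sum: "homogeneity d \<rho> \<kappa> (sum \<tau> A) = (\<Sum>i\<in>A. homogeneity d \<rho> \<kappa> (\<tau> i))"
  by (induction A rule: infinite_finite_induct) simp_all

lemma homogeneity_monomial:
  "homogeneity d \<rho> \<kappa> (monomial d k) = real (k 0) * \<rho> + real (\<Sum>i=1..d. k i)"
proof -
  have "homogeneity d \<rho> \<kappa> (monomial d k) = (\<Sum>i\<le>d. real (k i) * (if i = 0 then \<rho> else 1))"
    unfolding monomial_def homogeneity_sum by (simp add: homogeneity_def)
  also have "{..d} = insert 0 {1..d}" by auto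
  finally show ?thesis by simp
qed

text \<open>Monomials contain no atoms other than \<open>Var i\<close>. Needed for the side
  condition on \<open>Integ\<close> in \<open>\<U>\<close>.\<close>

lemma Noise_notin_monomials: "{#Noise#} \<notin> monomials d"
  and add_mset_Integ_notin_monomials: "add_mset (Integ \<sigma>) \<tau> \<notin> monomials d"
proof -
  have "set_mset (monomial n k) \<subseteq> range Var" for n k
    by (auto simp: monomial_def set_mset_sum split: if_splits)
  then have "set_mset \<tau> \<subseteq> range Var" if "\<tau> \<in> monomials d" for \<tau>
    using that by (auto simp: monomials_def)
  from this[of "{#Noise#}"] this[of "add_mset (Integ \<sigma>) \<tau>"]
  show "{#Noise#} \<notin> monomials d" "add_mset (Integ \<sigma>) \<tau> \<notin> monomials d"
    by auto
qed

section \<open>Upper bound: a parametrized set of candidate homogeneities\<close>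

text \<open>Each noise is counted in \<open>p\<close> together with the integration acting on it, so
  \<open>e\<close> counts only the other integrations and the factors \<open>Var 0\<close>, while
  \<open>j\<close> counts the spatial variables. The parameter \<open>s\<close> bounds the number of
  branches at the root; every integration counted in \<open>e\<close> trades one branch for at most
  \<open>N\<close>.\<close>

definition grid :: "nat \<Rightarrow> real \<Rightarrow> real \<Rightarrow> nat \<Rightarrow> real set" where
  "grid N \<rho> \<beta> s = {real p * \<beta> + real e * \<rho> + real j | p e j. p \<le> s + e * (N - 1)}"

lemma gridI:
  assumes "x = real p * \<beta> + real e * \<rho> + real j" "p \<le> s + e * (N - 1)"
  shows "x \<in> grid N \<rho> \<beta> s"
  using assms by (auto simp: grid_def)

lemma gridE:
  assumes "x \<in> grid N \<rho> \<beta> s"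
  obtains p e j where "x = real p * \<beta> + real e * \<rho> + real j" "p \<le> s + e * (N - 1)"
  using assms by (auto simp: grid_def)

lemma grid_mono: "s \<le> t \<Longrightarrow> grid N \<rho> \<beta> s \<subseteq> grid N \<rho> \<beta> t"
  by (fastforce simp: grid_def)

lemma grid_add:
  assumes "x \<in> grid N \<rho> \<beta> s" "y \<in> grid N \<rho> \<beta> t"
  shows "x + y \<in> grid N \<rho> \<beta> (s + t)"
proof -
  obtain p e j where x: "x = real p * \<beta> + real e * \<rho> + real j" "p \<le> s + e * (N - 1)"
    using assms(1) by (rule gridE)
  obtain q f l where y: "y = real q * \<beta> + real f * \<rho> + real l" "q \<le> t + f * (N - 1)"
    using assms(2) by (rule gridE)
  show ?thesis
    by (rule gridI[where p = "p + q" and e = "e + f" and j = "j + l"])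
      (use x y in \<open>simp_all add: distrib_right\<close>)
qed

lemma grid_sum:
  assumes "finite A" "\<And>i. i \<in> A \<Longrightarrow> f i \<in> grid N \<rho> \<beta> 1"
  shows "sum f A \<in> grid N \<rho> \<beta> (card A)"
  using assms
proof (induction A)
  case empty
  show ?case by (rule gridI[where p = 0 and e = 0 and j = 0]) auto
next
  case (insert i A)
  then show ?case using grid_add[of "f i" N \<rho> \<beta> 1 "sum f A" "card A"] by simp
qed

text \<open>A product of up to \<open>N\<close> factors becomes a single branch:
  \<open>N + e * (N - 1) = 1 + Suc e * (N - 1)\<close> for \<open>N \<ge> 1\<close>.\<close>

lemma grid_Integ:
  assumes "x \<in> grid N \<rho> \<beta> N" "N \<ge> 1"
  shows "x + \<rho> \<in> grid N \<rho> \<beta> 1"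
proof -
  obtain p e j where x: "x = real p * \<beta> + real e * \<rho> + real j" "p \<le> N + e * (N - 1)"
    using assms(1) by (rule gridE)
  show ?thesis
    by (rule gridI[where p = p and e = "Suc e" and j = j])
      (use x assms(2) in \<open>auto simp: algebra_simps\<close>)
qed

text \<open>The noise stands apart because \<open>\<alpha> = (\<alpha> + \<rho>) - \<rho>\<close>
  would correspond to \<open>e = -1\<close>; once integrated, it is the point \<open>p = 1\<close>,
  \<open>e = 0\<close>, \<open>j = 0\<close>.\<close>

lemma homogeneity_W_U:
  fixes d :: nat and \<rho> \<kappa> :: real
  assumes "N \<ge> 1"
  defines "\<alpha> \<equiv> noise_hom d \<rho> \<kappa>"
  shows "(\<forall>\<tau>\<in>\<W> N d m. homogeneity d \<rho> \<kappa> \<tau> \<in> insert \<alpha> (grid N \<rho> (\<alpha> + \<rho>) N)) \<and>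
    (\<forall>\<tau>\<in>\<U> N d m. homogeneity d \<rho> \<kappa> \<tau> \<in> grid N \<rho> (\<alpha> + \<rho>) 1)"
proof (induction m)
  case (Suc m)
  let ?h = "homogeneity d \<rho> \<kappa>" and ?g = "grid N \<rho> (\<alpha> + \<rho>)"
  have product: "?h (\<Sum>i=1..n. \<tau> i) \<in> ?g N"
    if "n \<in> {1..N}" "\<forall>i\<in>{1..n}. \<tau> i \<in> \<U> N d m" for n \<tau>
  proof -
    have "(\<Sum>i=1..n. ?h (\<tau> i)) \<in> ?g (card {1..n})"
      using that(2) Suc.IH by (intro grid_sum) auto
    then show ?thesis
      using that(1) grid_mono[of n N N \<rho> "\<alpha> + \<rho>"] by (auto simp: homogeneity_sum)
  qed
  have W: "?h \<tau> \<in> insert \<alpha> (?g N)" if "\<tau> \<in> \<W> N d (Suc m)" for \<tau>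
    using that Suc.IH product by (auto simp: \<alpha>_def)
  have monomial: "?h (monomial d k) \<in> ?g 1" for k
    by (rule gridI[where p = 0 and e = "k 0" and j = "\<Sum>i=1..d. k i"])
      (simp_all add: homogeneity_monomial)
  have "\<alpha> + \<rho> \<in> ?g 1"
    by (rule gridI[where p = 1 and e = 0 and j = 0]) auto
  then have "?h {#Integ \<tau>#} \<in> ?g 1" if "\<tau> \<in> \<W> N d (Suc m)" for \<tau>
    using W[OF that] grid_Integ[OF _ assms(1)] by auto
  then have "?h \<tau> \<in> ?g 1" if "\<tau> \<in> \<U> N d (Suc m)" for \<tau>
    using that monomial by (auto simp: monomials_def simp del: \<W>.simps)
  with W show ?case by blast
qed simp

lemma homogeneity_F:
  fixes d :: nat and \<rho> \<kappa> :: real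
  assumes "N \<ge> 1" "\<tau> \<in> \<F> N d"
  defines "\<alpha> \<equiv> noise_hom d \<rho> \<kappa>"
  shows "homogeneity d \<rho> \<kappa> \<tau> \<in> insert \<alpha> (grid N \<rho> (\<alpha> + \<rho>) N)"
  using assms(2)
    homogeneity_W_U[OF assms(1), where d = d and \<rho> = \<rho> and \<kappa> = \<kappa>]
    grid_mono[OF assms(1), of N \<rho> "\<alpha> + \<rho>"]
  unfolding \<F>_def \<alpha>_def by blast

text \<open>In \<open>N \<beta> + e G - b \<beta> + j\<close> with \<open>\<beta> < 0\<close> the
  last three terms are nonnegative, so a negative sum forces each of them below
  \<open>N (- \<beta>)\<close>.\<close>

lemma negative_grid_subset:
  fixes N :: nat and \<rho> \<beta> :: real
  defines "G \<equiv> \<rho> + (real N - 1) * \<beta>"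
  assumes "N \<ge> 1" "\<rho> > 0" "G > 0" "real N * (- \<beta>) < real M * G" "real N * (- \<beta>) < real d"
  shows "{\<gamma> \<in> grid N \<rho> \<beta> N. \<gamma> < 0} \<subseteq>
    (\<lambda>(e, b, j). real N * \<beta> + real e * G - real b * \<beta> + real j) ` ({..<M} \<times> {..<N} \<times> {..<d})"
proof safe
  fix \<gamma> assume "\<gamma> \<in> grid N \<rho> \<beta> N" and neg: "\<gamma> < 0"
  then obtain p e j where \<gamma>: "\<gamma> = real p * \<beta> + real e * \<rho> + real j" and p: "p \<le> N + e * (N - 1)"
    by (elim gridE)
  define b where "b = N + e * (N - 1) - p"
  have "real p + real b = real N + real e * (real N - 1)"
    using p assms(2) by (simp add: b_def of_nat_diff)
  then have p_eq: "real p = real N + real e * (real N - 1) - real b"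
    by simp
  have \<gamma>': "\<gamma> = real N * \<beta> + real e * G - real b * \<beta> + real j"
    unfolding \<gamma> p_eq G_def by (simp add: algebra_simps)
  \<comment> \<open>The sign of \<open>\<beta>\<close> comes from \<open>\<gamma>\<close>: for
    \<open>\<beta> \<ge> 0\<close> every grid point is nonnegative.\<close>
  have "\<beta> < 0"
  proof (rule ccontr)
    assume "\<not> \<beta> < 0"
    then have "\<gamma> \<ge> 0" unfolding \<gamma> using assms(3) by simp
    with neg show False by simp
  qed
  then have b\<beta>: "real b * \<beta> \<le> 0" by (simp add: mult_nonneg_nonpos)
  have eG: "real e * G \<ge> 0" using assms(4) by simp
  have "real e * G < real M * G"
    using neg \<gamma>' b\<beta> assms(5) by auto
  then have "e < M" using assms(4) by simp
  moreover have "real b * (- \<beta>) < real N * (- \<beta>)"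
    using neg \<gamma>' eG by auto
  then have "b < N" using \<open>\<beta> < 0\<close> by simp
  moreover have "real j < real d"
    using neg \<gamma>' b\<beta> eG assms(6) by auto
  then have "j < d" by simp
  ultimately show "\<gamma> \<in> (\<lambda>(e, b, j). real N * \<beta> + real e * G - real b * \<beta> + real j) `
      ({..<M} \<times> {..<N} \<times> {..<d})"
    using \<gamma>' by (intro image_eqI[where x = "(e, b, j)"]) auto
qed

section \<open>Lower bound: trees with full branching\<close>

text \<open>A comb: only one of the \<open>N\<close> branches at each vertex is continued. One such
  tree for each number \<open>a\<close> of branching vertices suffices, since the homogeneity
  depends on \<open>a\<close> alone.\<close>

primrec full_tree :: "nat \<Rightarrow> nat \<Rightarrow> symbol" where
  "full_tree N 0 = {#Noise#}"
| "full_tree N (Suc a) = add_mset (Integ (full_tree N a)) (replicate_mset (N - 1) (Integ {#Noise#}))"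

lemma homogeneity_full_tree:
  assumes "N \<ge> 1"
  shows "homogeneity d \<rho> \<kappa> (full_tree N a) =
    noise_hom d \<rho> \<kappa> + real a * (\<rho> + (real N - 1) * (noise_hom d \<rho> \<kappa> + \<rho>))"
proof (induction a)
  case (Suc a)
  have "homogeneity d \<rho> \<kappa> (full_tree N (Suc a)) =
      homogeneity d \<rho> \<kappa> (full_tree N a) + \<rho> + (real N - 1) * (noise_hom d \<rho> \<kappa> + \<rho>)"
    using assms by (simp add: homogeneity_def of_nat_diff)
  then show ?case using Suc by (simp add: algebra_simps)
qed simp

lemma Noise_in_W: "{#Noise#} \<in> \<W> N d (Suc m)"
  by simp

lemma full_tree_in_W:
  assumes "N \<ge> 1"
  shows "full_tree N a \<in> \<W> N d (Suc a)"
proof (induction a)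
  case (Suc a)
  define \<tau> where
    "\<tau> i = (if i = 1 then {#Integ (full_tree N a)#} else {#Integ {#Noise#}#})" for i :: nat
  have "full_tree N a \<notin> monomials d"
    by (cases a) (simp_all add: Noise_notin_monomials add_mset_Integ_notin_monomials)
  then have "\<forall>i\<in>{1..N}. \<tau> i \<in> \<U> N d (Suc a)"
    using Suc Noise_in_W[of N d a] Noise_notin_monomials
    by (auto simp: \<tau>_def simp del: \<W>.simps)
  moreover have "full_tree N (Suc a) = (\<Sum>i=1..N. \<tau> i)"
  proof -
    have "{1..N} = insert 1 {2..N}" using assms by auto
    then have "(\<Sum>i=1..N. \<tau> i) = \<tau> 1 + (\<Sum>i=2..N. \<tau> i)" by simp
    also have "(\<Sum>i=2..N. \<tau> i) = (\<Sum>i=2..N. {#Integ {#Noise#}#})"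
      by (intro sum.cong) (auto simp: \<tau>_def)
    also have "\<dots> = replicate_mset (N - 1) (Integ {#Noise#})"
    proof (rule multiset_eqI)
      fix y
      show "count (\<Sum>i=2..N. {#Integ {#Noise#}#}) y =
          count (replicate_mset (N - 1) (Integ {#Noise#})) y"
        by (simp add: count_sum)
    qed
    finally show ?thesis by (simp add: \<tau>_def)
  qed
  ultimately show ?case
    using assms unfolding \<W>.simps(2)[of N d "Suc a"]
    by (intro UnI2 UN_I[where a = N] CollectI exI[where x = \<tau>]) auto
qed simp

section \<open>Choice of \<open>\<kappa>\<^sub>0\<close> and counting\<close>

theorem theorem4p12:
  fixes N d :: nat and \<rho> :: real
  assumes "N \<ge> 1" and "d \<ge> 1"
    and "0 < \<rho>" and "\<rho> \<le> 2"
    and "\<rho> > \<rho>\<^sub>c N d"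
  shows "\<exists>\<kappa>\<^sub>0>0. \<forall>\<kappa>. 0 < \<kappa> \<and> \<kappa> < \<kappa>\<^sub>0 \<longrightarrow>
    (\<rho> + real d) / (real N + 1) * inverse (\<rho> - \<rho>\<^sub>c N d) \<le> real (h\<^sub>F N d \<rho> \<kappa>) \<and>
    real (h\<^sub>F N d \<rho> \<kappa>)
      \<le> 1 + (\<rho> + real d) * real d * real N / (real N + 1) * inverse (\<rho> - \<rho>\<^sub>c N d)"
proof -
  define \<beta> where "\<beta> \<kappa> = noise_hom d \<rho> \<kappa> + \<rho>" for \<kappa>
  define G where "G \<kappa> = \<rho> + (real N - 1) * \<beta> \<kappa>" for \<kappa>
  \<comment> \<open>By \<open>x_G0\<close>, this is the number of steps of size \<open>G 0\<close>
    leading from the noise homogeneity at \<open>\<kappa> = 0\<close> up to 0.\<close>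
  define x where "x = (\<rho> + real d) / (real N + 1) * inverse (\<rho> - \<rho>\<^sub>c N d)"
  define M where "M = nat \<lfloor>x\<rfloor>"
  have \<beta>_eq: "\<beta> \<kappa> = (\<rho> - real d) / 2 - \<kappa>" for \<kappa>
    by (simp add: \<beta>_def noise_hom_def field_simps)
  have G0: "G 0 = (real N + 1) * (\<rho> - \<rho>\<^sub>c N d) / 2"
    by (simp add: G_def \<beta>_eq \<rho>\<^sub>c_def field_simps)
  then have G0_pos: "G 0 > 0" using assms(5) by (simp del: eq_divide_eq_numeral1)
  have x_G0: "x * G 0 = (\<rho> + real d) / 2"
  proof -
    have "(a / n * inverse r) * (n * r / 2) = a / 2" if "n \<noteq> 0" "r \<noteq> 0" for a n r :: real
      using that by (simp add: field_simps)
    then show ?thesis unfolding x_def G0 using assms(5) by simp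
  qed
  have x_pos: "x > 0" unfolding x_def using assms by simp
  have M_le: "real M \<le> x" and x_less: "x < real M + 1"
    unfolding M_def using x_pos by linarith+
  have cont: "\<beta> \<midarrow>0\<rightarrow> \<beta> 0" "G \<midarrow>0\<rightarrow> G 0"
    unfolding G_def \<beta>_eq by (auto intro!: tendsto_eq_intros)
  \<comment> \<open>The hypotheses of \<open>negative_grid_subset\<close> that involve
    \<open>\<kappa>\<close> are strict at \<open>\<kappa> = 0\<close>, hence persist nearby by
    continuity.\<close>
  have "\<forall>\<^sub>F \<kappa> in at 0. G \<kappa> > 0"
    using cont(2) G0_pos by (rule order_tendstoD)
  moreover have "\<forall>\<^sub>F \<kappa> in at 0. real M * G \<kappa> + real N * \<beta> \<kappa> > 0"
  proof (rule order_tendstoD(1))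
    show "(\<lambda>\<kappa>. real M * G \<kappa> + real N * \<beta> \<kappa>) \<midarrow>0\<rightarrow> real M * G 0 + real N * \<beta> 0"
      by (intro tendsto_intros cont)
    \<comment> \<open>The floor suffices because \<open>N (- \<beta> 0) = (x - 1) G 0\<close> and
      \<open>x - 1 < M\<close>.\<close>
    have "x * G 0 < (real M + 1) * G 0" using x_less G0_pos by simp
    moreover have "G 0 + real N * (- \<beta> 0) = (\<rho> + real d) / 2"
      by (simp add: G_def \<beta>_eq field_simps)
    ultimately show "0 < real M * G 0 + real N * \<beta> 0"
      using x_G0 by (simp add: algebra_simps)
  qed
  moreover have "\<forall>\<^sub>F \<kappa> in at 0. real d + real N * \<beta> \<kappa> > 0"
  proof (rule order_tendstoD(1))
    show "(\<lambda>\<kappa>. real d + real N * \<beta> \<kappa>) \<midarrow>0\<rightarrow> real d + real N * \<beta> 0"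
      by (intro tendsto_intros cont)
    \<comment> \<open>This is \<open>\<rho> > \<rho>\<^sub>c\<close>, equivalently
      \<open>\<beta> 0 > - d / (N + 1)\<close>; hence \<open>d + N \<beta> 0\<close> is at least
      \<open>d / (N + 1)\<close>.\<close>
    have "(real N + 1) * \<rho> > (real N - 1) * real d"
      using G0_pos by (simp add: G_def \<beta>_eq field_simps)
    then have "real N * ((real N - 1) * real d) \<le> real N * ((real N + 1) * \<rho>)"
      by (intro mult_left_mono) auto
    then have "(real N + 1) * (real d + real N * \<beta> 0) \<ge> real d"
      by (simp add: \<beta>_eq field_simps)
    then have "(real N + 1) * (real d + real N * \<beta> 0) > 0"
      using assms(2) by linarith
    then show "0 < real d + real N * \<beta> 0"
      by (simp add: zero_less_mult_iff)
  qed
  ultimately have "\<forall>\<^sub>F \<kappa> in at 0. G \<kappa> > 0 \<and> real M * G \<kappa> + real N * \<beta> \<kappa> > 0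
      \<and> real d + real N * \<beta> \<kappa> > 0"
    by eventually_elim auto
  then obtain \<kappa>\<^sub>0 where "\<kappa>\<^sub>0 > 0" and small: "\<And>\<kappa>. 0 < \<kappa> \<Longrightarrow> \<kappa> < \<kappa>\<^sub>0 \<Longrightarrow> G \<kappa> > 0 \<and>
      real M * G \<kappa> + real N * \<beta> \<kappa> > 0 \<and> real d + real N * \<beta> \<kappa> > 0"
    unfolding eventually_at by (auto simp: dist_real_def)
  have "x \<le> real (h\<^sub>F N d \<rho> \<kappa>) \<and> real (h\<^sub>F N d \<rho> \<kappa>) \<le> 1 + x * real N * real d"
    if \<kappa>: "0 < \<kappa>" "\<kappa> < \<kappa>\<^sub>0" for \<kappa>
  proof -
    define S where "S = {\<gamma>. \<gamma> < 0 \<and> (\<exists>\<tau>\<in>\<F> N d. homogeneity d \<rho> \<kappa> \<tau> = \<gamma>)}"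
    define B where "B = {..<M} \<times> {..<N} \<times> {..<d}"
    define f where "f = (\<lambda>(e :: nat, b :: nat, j :: nat).
      real N * \<beta> \<kappa> + real e * G \<kappa> - real b * \<beta> \<kappa> + real j)"
    have "{\<gamma> \<in> grid N \<rho> (\<beta> \<kappa>) N. \<gamma> < 0} \<subseteq> f ` B"
      using negative_grid_subset[of N \<rho> "\<beta> \<kappa>" M d] small[OF \<kappa>] assms
      unfolding f_def B_def G_def by auto
    then have sub: "S \<subseteq> insert (noise_hom d \<rho> \<kappa>) (f ` B)"
      using homogeneity_F[OF assms(1), where d = d and \<rho> = \<rho> and \<kappa> = \<kappa>]
      unfolding S_def \<beta>_def by blast
    have "finite B" by (simp add: B_def)
    then have fin: "finite S" using finite_subset[OF sub] by simp
    have "card S \<le> card (insert (noise_hom d \<rho> \<kappa>) (f ` B))"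
      using sub \<open>finite B\<close> by (intro card_mono) auto
    also have "\<dots> \<le> Suc (card (f ` B))"
      using \<open>finite B\<close> by (simp add: card_insert_if)
    also have "\<dots> \<le> Suc (card B)" using \<open>finite B\<close> by (simp add: card_image_le)
    also have "card B = M * N * d" by (simp add: B_def card_cartesian_product)
    finally have "real (card S) \<le> 1 + real M * real N * real d"
      by (metis of_nat_Suc of_nat_le_iff of_nat_mult add.commute)
    also have "\<dots> \<le> 1 + x * real N * real d"
      using M_le by (intro add_left_mono mult_right_mono) auto
    finally have upper: "real (card S) \<le> 1 + x * real N * real d" .
    define H where "H a = homogeneity d \<rho> \<kappa> (full_tree N a)" for a
    have H: "H a = noise_hom d \<rho> \<kappa> + real a * G \<kappa>" for a
      unfolding H_def G_def \<beta>_def by (rule homogeneity_full_tree[OF assms(1)])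
    \<comment> \<open>The naturals below \<open>x\<close>, strictly, are those below its ceiling, so
      there are at least \<open>x\<close> of them.\<close>
    have "H ` {..<nat \<lceil>x\<rceil>} \<subseteq> S"
    proof safe
      fix a assume "a < nat \<lceil>x\<rceil>"
      then have "real a < x" using x_pos by linarith
      then have "real a * G 0 < x * G 0" using G0_pos by simp
      \<comment> \<open>A positive \<open>\<kappa>\<close> lowers both the noise homogeneity and the
        increment, so negativity follows from the comparison at \<open>\<kappa> = 0\<close>.\<close>
      moreover have "\<beta> \<kappa> \<le> \<beta> 0" unfolding \<beta>_eq using \<kappa>(1) by linarith
      then have "G \<kappa> \<le> G 0"
        unfolding G_def using assms(1) by (intro add_left_mono mult_left_mono) auto
      then have "real a * G \<kappa> \<le> real a * G 0" by (intro mult_left_mono) auto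
      ultimately have "H a < 0"
        using x_G0 \<kappa>(1) unfolding H noise_hom_def by argo
      moreover have "full_tree N a \<in> \<F> N d"
        using full_tree_in_W[OF assms(1), of a d] unfolding \<F>_def by blast
      ultimately show "H a \<in> S" unfolding S_def H_def by blast
    qed
    then have "card (H ` {..<nat \<lceil>x\<rceil>}) \<le> card S" by (rule card_mono[OF fin])
    moreover have "inj_on H {..<nat \<lceil>x\<rceil>}"
      using small[OF \<kappa>] by (auto simp: inj_on_def H)
    ultimately have "nat \<lceil>x\<rceil> \<le> card S" by (simp add: card_image)
    then have "x \<le> real (card S)" by linarith
    with upper show ?thesis by (simp add: h\<^sub>F_def S_def)
  qed
  moreover have "(\<rho> + real d) * real d * real N / (real N + 1) * inverse (\<rho> - \<rho>\<^sub>c N d)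
      = x * real N * real d"
    by (simp add: x_def)
  ultimately show ?thesis
    using \<open>\<kappa>\<^sub>0 > 0\<close> unfolding x_def[symmetric] by metis
qed

end
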